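(* Let $n,m$ be coprime positive integers. Then an array $A\in\mathcal{S}_{n,m}$ is extremal if and only if $$|\operatorname{supp}A| = n+m-1.$$
   Context: An $n\times m$ real matrix $A=(a_{ij})$ is called a doubly stochastic array (with uniform marginals) if $a_{ij}\geq 0$ for all $i,j$, $\sum_{j=1}^m a_{ij}=m$ for every $1\leq i\leq n$, and $\sum_{i=1}^n a_{ij}=n$ for every $1\leq j\leq m$. The set of all such arrays is denoted $\mathcal{S}_{n,m}$; it is a convex polytope. An array $A\in\mathcal{S}_{n,m}$ is called extremal if it is an extreme point of $\mathcal{S}_{n,m}$, i.e. it cannot be represented as a convex combination of two other elements of $\mathcal{S}_{n,m}$ that are both different from $A$. The support of a matrix $A=(a_{ij})$ is $\operatorname{supp}A=\{(i,j): a_{ij}\neq 0\}$. *)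

theory Defs
  imports "HOL-Analysis.Analysis"
begin

text \<open>
  A real n x m array is an element of type \<open>real ^ 'm ^ 'n\<close> with \<open>n = CARD('n)\<close> rows and
  \<open>m = CARD('m)\<close> columns; \<open>A $ i $ j\<close> is the entry in row \<open>i\<close> and column \<open>j\<close>.
  Finite index types are nonempty, so n and m are positive.

  The marginals are unnormalised: each row sums to the number of columns and each column
  to the number of rows.
\<close>

definition doubly_stochastic_arrays :: "(real ^ 'm::finite ^ 'n::finite) set" where
  "doubly_stochastic_arrays =
     {A. (\<forall>i j. A $ i $ j \<ge> 0) \<and>
         (\<forall>i. (\<Sum>j\<in>UNIV. A $ i $ j) = real CARD('m)) \<and>
         (\<forall>j. (\<Sum>i\<in>UNIV. A $ i $ j) = real CARD('n))}"

definition array_support :: "real ^ 'm::finite ^ 'n::finite \<Rightarrow> ('n \<times> 'm) set" where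
  "array_support A = {(i, j). A $ i $ j \<noteq> 0}"

end

theory Submission
  imports Defs
begin

text \<open>
  Read a set \<open>S\<close> of positions as a bipartite graph whose vertices are the rows and the columns and
  whose edges are the pairs in \<open>S\<close>.  The theorem is a count of cycles in the graph of
  \<open>array_support A\<close>.

  One can move away from \<open>A\<close> in both of two opposite directions, staying in the polytope, exactly
  along the matrices that vanish off the support of \<open>A\<close> and have zero row and column sums; so \<open>A\<close>
  is extremal iff zero is the only such matrix (\<open>extreme_iff_no_circulation\<close>).  These matrices,
  called circulations below, form the cycle space of the graph.  For a connected graph with
  \<open>n + m\<close> vertices its dimension is the number of edges minus \<open>n + m - 1\<close>
  (\<open>dim_circulations\<close>), so it is trivial iff the graph has \<open>n + m - 1\<close> edges.

  Coprimality supplies connectedness (\<open>connected_support\<close>).  A union of components with row set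
  \<open>R\<close> and column set \<open>C\<close> carries the total mass \<open>card R * m\<close> counted by rows and \<open>card C * n\<close>
  counted by columns.  Since \<open>n\<close> and \<open>m\<close> are coprime, \<open>card R * m = card C * n\<close> forces \<open>n\<close> to
  divide \<open>card R\<close>, so \<open>R\<close> is empty or everything, and then so is \<open>C\<close>.
\<close>

section \<open>Circulations on a bipartite graph\<close>

definition matrices_on :: "('n \<times> 'm) set \<Rightarrow> (real ^ 'm::finite ^ 'n::finite) set" where
  "matrices_on S = {M. \<forall>i j. (i, j) \<notin> S \<longrightarrow> M $ i $ j = 0}"

definition circulations :: "('n \<times> 'm) set \<Rightarrow> (real ^ 'm::finite ^ 'n::finite) set" where
  "circulations S = {M \<in> matrices_on S.
     (\<forall>i. (\<Sum>j\<in>UNIV. M $ i $ j) = 0) \<and> (\<forall>j. (\<Sum>i\<in>UNIV. M $ i $ j) = 0)}"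

text \<open>
  Connectedness is phrased through vertex sets closed under adjacency, a form that both the mass
  count and the comparison of potentials below use directly, without speaking of paths.
\<close>

definition connected_positions :: "('n \<times> 'm) set \<Rightarrow> bool" where
  "connected_positions S \<longleftrightarrow>
     (\<forall>R C. (\<forall>(i, j)\<in>S. i \<in> R \<longleftrightarrow> j \<in> C) \<longrightarrow>
       R = {} \<and> C = {} \<or> R = UNIV \<and> C = UNIV)"

text \<open>
  The coboundary of the potential with value \<open>u\<close> on the rows and \<open>- v\<close> on the columns.  The sign is
  chosen so that it is the transpose of the map taking a matrix to its row and column sums.
\<close>

definition coboundary ::
    "('n \<times> 'm) set \<Rightarrow> (real ^ 'n) \<times> (real ^ 'm) \<Rightarrow> real ^ 'm::finite ^ 'n::finite" where
  "coboundary S p = (\<chi> i j. if (i, j) \<in> S then fst p $ i + snd p $ j else 0)"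

lemma linear_coboundary: "linear (coboundary S)"
  by (rule linearI) (auto simp: coboundary_def vec_eq_iff algebra_simps)

lemma subspace_matrices_on: "subspace (matrices_on S)"
  by (auto simp: subspace_def matrices_on_def)

lemma subspace_circulations: "subspace (circulations S)"
  using subspace_matrices_on[of S]
  by (auto simp: subspace_def circulations_def sum.distrib simp flip: sum_distrib_left)

lemma dim_matrices_on:
  fixes S :: "('n::finite \<times> 'm::finite) set"
  shows "dim (matrices_on S :: (real ^ 'm ^ 'n) set) = card S"
proof -
  define unit :: "'n \<times> 'm \<Rightarrow> real ^ 'm ^ 'n" where "unit = (\<lambda>(i, j). axis i (axis j 1))"
  have inj: "inj unit"
    by (auto simp: inj_def unit_def axis_eq_axis)
  have Basis: "(Basis :: (real ^ 'm ^ 'n) set) = range unit"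
    by (auto simp: Basis_vec_def unit_def image_iff)
  have "matrices_on S = {M :: real ^ 'm ^ 'n. \<forall>b\<in>Basis. b \<notin> unit ` S \<longrightarrow> M \<bullet> b = 0}"
    unfolding Basis by (auto simp: matrices_on_def inj_image_mem_iff[OF inj])
      (auto simp: unit_def inner_axis)
  moreover have "unit ` S \<subseteq> Basis"
    by (auto simp: Basis)
  ultimately have "dim (matrices_on S :: (real ^ 'm ^ 'n) set) = card (unit ` S)"
    by (simp only: dim_substandard)
  then show ?thesis
    by (simp add: card_image inj_on_subset[OF inj])
qed

lemma inner_coboundary:
  assumes "M \<in> matrices_on S"
  shows "M \<bullet> coboundary S (u, v) =
    (\<Sum>i\<in>UNIV. u $ i * (\<Sum>j\<in>UNIV. M $ i $ j)) + (\<Sum>j\<in>UNIV. v $ j * (\<Sum>i\<in>UNIV. M $ i $ j))"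
proof -
  have "M \<bullet> coboundary S (u, v) = (\<Sum>i\<in>UNIV. \<Sum>j\<in>UNIV. u $ i * M $ i $ j + v $ j * M $ i $ j)"
    using assms unfolding inner_vec_def
    by (intro sum.cong refl) (auto simp: coboundary_def matrices_on_def algebra_simps)
  also have "\<dots> = (\<Sum>i\<in>UNIV. \<Sum>j\<in>UNIV. u $ i * M $ i $ j) + (\<Sum>j\<in>UNIV. \<Sum>i\<in>UNIV. v $ j * M $ i $ j)"
    by (subst (3) sum.swap) (simp add: sum.distrib)
  finally show ?thesis
    by (simp add: sum_distrib_left)
qed

text \<open>
  Cycles are orthogonal to cuts: testing a matrix against the coboundaries of the indicators of
  single vertices reads off its row and column sums.
\<close>

lemma circulations_eq_orthogonal_complement:
  "circulations S = {M \<in> matrices_on S. \<forall>N \<in> range (coboundary S). orthogonal N M}"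
proof (intro set_eqI iffI)
  fix M assume "M \<in> circulations S"
  then show "M \<in> {M \<in> matrices_on S. \<forall>N \<in> range (coboundary S). orthogonal N M}"
    by (auto simp: circulations_def orthogonal_def inner_commute[of _ M] inner_coboundary)
next
  fix M assume "M \<in> {M \<in> matrices_on S. \<forall>N \<in> range (coboundary S). orthogonal N M}"
  then have M: "M \<in> matrices_on S" and orth: "M \<bullet> coboundary S p = 0" for p
    by (cases p; auto simp: orthogonal_def inner_commute[of _ M])+
  have "(\<Sum>j\<in>UNIV. M $ i $ j) = 0" for i
    using orth[of "(axis i 1, 0)"]
    by (simp add: inner_coboundary[OF M] axis_def if_distrib[of "\<lambda>x. x * _"] cong: if_cong)
  moreover have "(\<Sum>i\<in>UNIV. M $ i $ j) = 0" for j
    using orth[of "(0, axis j 1)"]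
    by (simp add: inner_coboundary[OF M] axis_def if_distrib[of "\<lambda>x. x * _"] cong: if_cong)
  ultimately show "M \<in> circulations S"
    using M by (simp add: circulations_def)
qed

text \<open>
  On a connected graph a potential whose coboundary vanishes is constant: the rows and columns on
  which it takes one of its values form a vertex set closed under adjacency.
\<close>

lemma coboundary_eq_0D:
  assumes "connected_positions S" and "coboundary S (u, v) = 0"
  shows "u $ i = - v $ j"
proof -
  have "u $ a = - v $ j \<longleftrightarrow> - v $ b = - v $ j" if "(a, b) \<in> S" for a b
  proof -
    have "coboundary S (u, v) $ a $ b = 0"
      using assms(2) by simp
    then have "u $ a = - v $ b"
      using that by (simp add: coboundary_def)
    then show ?thesis by simp
  qed
  then have "\<forall>(a, b)\<in>S. a \<in> {a. u $ a = - v $ j} \<longleftrightarrow> b \<in> {b. - v $ b = - v $ j}"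
    by auto
  then have "{a. u $ a = - v $ j} = UNIV"
    using assms(1) unfolding connected_positions_def by blast
  then show ?thesis by blast
qed

text \<open>
  Potentials have \<open>n + m\<close> coordinates, and constants are the only ones killed by the coboundary;
  fixing the value at one column to be zero therefore loses one dimension and no coboundary.
\<close>

lemma dim_range_coboundary:
  fixes S :: "('n::finite \<times> 'm::finite) set"
  assumes S: "connected_positions S"
  shows "dim (range (coboundary S)) = CARD('n) + CARD('m) - 1"
proof -
  fix k :: 'm
  define H where "H = {p :: (real ^ 'n) \<times> (real ^ 'm). (0, axis k 1) \<bullet> p = 0}"
  have H_iff: "p \<in> H \<longleftrightarrow> snd p $ k = 0" for p
    by (cases p) (simp add: H_def inner_axis')
  have subspace: "subspace H"
    unfolding H_def by (rule subspace_hyperplane)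
  have "inj_on (coboundary S) H"
  proof (subst linear_inj_on_iff_eq_0[OF linear_coboundary subspace], safe)
    fix u :: "real ^ 'n" and v :: "real ^ 'm"
    assume H: "(u, v) \<in> H" and 0: "coboundary S (u, v) = 0"
    have u: "u $ i = 0" for i
      using coboundary_eq_0D[OF S 0, of i k] H by (simp add: H_iff)
    moreover have "v $ j = 0" for j
      using coboundary_eq_0D[OF S 0, of undefined j] u by simp
    ultimately show "(u, v) = 0"
      by (simp add: vec_eq_iff zero_prod_def)
  qed
  moreover have "range (coboundary S) = coboundary S ` H"
  proof (intro equalityI subsetI)
    fix N assume "N \<in> range (coboundary S)"
    then obtain p where p: "N = coboundary S p" by blast
    have "N = coboundary S (fst p + vec (snd p $ k), snd p - vec (snd p $ k))"
      by (simp add: p coboundary_def vec_eq_iff)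
    moreover have "(fst p + vec (snd p $ k), snd p - vec (snd p $ k)) \<in> H"
      by (simp add: H_iff)
    ultimately show "N \<in> coboundary S ` H" by blast
  qed auto
  ultimately have "dim (range (coboundary S)) = dim H"
    using dim_image_eq[OF linear_coboundary, of S H] span_eq_iff[THEN iffD2, OF subspace] by simp
  also have "\<dots> = CARD('n) + CARD('m) - 1"
    unfolding H_def by (subst dim_hyperplane) (simp_all add: zero_prod_def axis_eq_0_iff)
  finally show ?thesis .
qed

text \<open>Euler's formula for the cycle space of a connected graph.\<close>

lemma dim_circulations:
  fixes S :: "('n::finite \<times> 'm::finite) set"
  assumes "connected_positions S"
  shows "dim (circulations S :: (real ^ 'm ^ 'n) set) + (CARD('n) + CARD('m) - 1) = card S"
proof -
  have "subspace (range (coboundary S))"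
    by (simp add: linear_subspace_image[OF linear_coboundary])
  moreover have "range (coboundary S) \<subseteq> matrices_on S"
    by (auto simp: coboundary_def matrices_on_def)
  ultimately have "dim (circulations S :: (real ^ 'm ^ 'n) set) + dim (range (coboundary S)) =
      dim (matrices_on S :: (real ^ 'm ^ 'n) set)"
    unfolding circulations_eq_orthogonal_complement
    by (intro dim_subspace_orthogonal_to_vectors subspace_matrices_on)
  then show ?thesis
    by (simp add: dim_range_coboundary[OF assms] dim_matrices_on)
qed

section \<open>Extremality and circulations\<close>

lemma add_circulation_in_doubly_stochastic:
  assumes "A \<in> doubly_stochastic_arrays" and "M \<in> circulations S"
    and "\<And>i j. \<bar>M $ i $ j\<bar> \<le> A $ i $ j"
  shows "A + M \<in> doubly_stochastic_arrays"
proof -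
  have "0 \<le> A $ i $ j + M $ i $ j" for i j
    using assms(3)[of i j] by linarith
  then show ?thesis
    using assms(1,2) by (simp add: doubly_stochastic_arrays_def circulations_def sum.distrib)
qed

text \<open>
  A nonzero circulation on the support of \<open>A\<close> can be scaled until its entries are dominated by
  those of \<open>A\<close>, which are positive on the support.
\<close>

lemma not_extreme_if_circulation:
  fixes A M :: "real ^ 'm::finite ^ 'n::finite"
  assumes A: "A \<in> doubly_stochastic_arrays"
    and M: "M \<in> circulations (array_support A)" "M \<noteq> 0"
  shows "\<not> A extreme_point_of doubly_stochastic_arrays"
proof -
  \<comment> \<open>The summand 1 keeps the denominator positive where \<open>M\<close> vanishes inside the support.\<close>
  define e where "e = Min ((\<lambda>(i, j). A $ i $ j / (1 + \<bar>M $ i $ j\<bar>)) ` array_support A)"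
  have nonneg: "0 \<le> A $ i $ j" for i j
    using A by (simp add: doubly_stochastic_arrays_def)
  have supp: "A $ i $ j \<noteq> 0" if "M $ i $ j \<noteq> 0" for i j
    using M(1) that by (auto simp: circulations_def matrices_on_def array_support_def)
  obtain i0 j0 where "M $ i0 $ j0 \<noteq> 0"
    using M(2) by (auto simp: vec_eq_iff)
  with supp have "array_support A \<noteq> {}"
    by (auto simp: array_support_def)
  then have "0 < e"
    unfolding e_def using nonneg
    by (subst Min_gr_iff) (auto simp: array_support_def order.strict_iff_order)
  have bound: "\<bar>e * M $ i $ j\<bar> \<le> A $ i $ j" for i j
  proof (cases "M $ i $ j = 0")
    case False
    then have "(i, j) \<in> array_support A"
      using supp by (simp add: array_support_def)
    then have "e \<le> A $ i $ j / (1 + \<bar>M $ i $ j\<bar>)"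
      unfolding e_def by (intro Min_le) auto
    then have "e * (1 + \<bar>M $ i $ j\<bar>) \<le> A $ i $ j"
      by (subst (asm) pos_le_divide_eq) auto
    then show ?thesis
      using \<open>0 < e\<close> by (simp add: abs_mult algebra_simps)
  qed (simp add: nonneg)
  have "A + e *\<^sub>R M \<in> doubly_stochastic_arrays"
    using A M(1) bound
    by (intro add_circulation_in_doubly_stochastic[of A _ "array_support A"])
      (auto intro: subspace_scale[OF subspace_circulations])
  moreover have "A + (- e) *\<^sub>R M \<in> doubly_stochastic_arrays"
    using A M(1) bound
    by (intro add_circulation_in_doubly_stochastic[of A _ "array_support A"])
      (auto intro: subspace_neg[OF subspace_circulations] subspace_scale[OF subspace_circulations])
  moreover have "A \<in> open_segment (A + e *\<^sub>R M) (A + (- e) *\<^sub>R M)"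
  proof -
    have "A + e *\<^sub>R M \<noteq> A + (- e) *\<^sub>R M"
    proof
      assume "A + e *\<^sub>R M = A + (- e) *\<^sub>R M"
      then have "(2 * e) *\<^sub>R M = 0"
        by (simp add: vec_eq_iff)
      with \<open>0 < e\<close> M(2) show False by simp
    qed
    moreover have "A = (1 - 1/2) *\<^sub>R (A + e *\<^sub>R M) + (1/2) *\<^sub>R (A + (- e) *\<^sub>R M)"
      by (simp add: vec_eq_iff algebra_simps)
    ultimately show ?thesis
      unfolding in_segment by (intro conjI exI[of _ "1/2"]) auto
  qed
  ultimately show ?thesis
    unfolding extreme_point_of_def by blast
qed

text \<open>
  Nonnegative arrays cannot cancel, so both ends of a segment through \<open>A\<close> vanish where \<open>A\<close> does;
  their difference is then a circulation on the support of \<open>A\<close>.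
\<close>

lemma circulation_if_not_extreme:
  fixes A :: "real ^ 'm::finite ^ 'n::finite"
  assumes A: "A \<in> doubly_stochastic_arrays"
    and not_extreme: "\<not> A extreme_point_of doubly_stochastic_arrays"
  shows "\<exists>M \<in> circulations (array_support A). M \<noteq> 0"
proof -
  obtain X Y where X: "X \<in> doubly_stochastic_arrays" and Y: "Y \<in> doubly_stochastic_arrays"
    and "A \<in> open_segment X Y"
    using A not_extreme by (auto simp: extreme_point_of_def)
  then obtain t where t: "0 < t" "t < 1" and eq: "A = (1 - t) *\<^sub>R X + t *\<^sub>R Y" and "X \<noteq> Y"
    by (auto simp: in_segment)
  have nonneg: "0 \<le> X $ i $ j" "0 \<le> Y $ i $ j" for i j
    using X Y by (auto simp: doubly_stochastic_arrays_def)
  have "X $ i $ j = 0 \<and> Y $ i $ j = 0" if "A $ i $ j = 0" for i j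
  proof -
    have "(1 - t) * X $ i $ j + t * Y $ i $ j = 0"
      using that by (simp add: eq)
    moreover have "0 \<le> (1 - t) * X $ i $ j" "0 \<le> t * Y $ i $ j"
      using t nonneg by simp_all
    ultimately have "(1 - t) * X $ i $ j = 0" "t * Y $ i $ j = 0"
      by linarith+
    then show ?thesis using t by simp
  qed
  then have "X - Y \<in> circulations (array_support A)"
    using X Y by (auto simp: circulations_def matrices_on_def array_support_def
        doubly_stochastic_arrays_def sum_subtractf)
  with \<open>X \<noteq> Y\<close> show ?thesis
    by (intro bexI[of _ "X - Y"]) auto
qed

lemma extreme_iff_no_circulation:
  assumes "A \<in> doubly_stochastic_arrays"
  shows "A extreme_point_of doubly_stochastic_arrays \<longleftrightarrow>
    circulations (array_support A) \<subseteq> {0}"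
  using not_extreme_if_circulation[OF assms] circulation_if_not_extreme[OF assms] by blast

section \<open>Connectedness of the support\<close>

lemma connected_support:
  fixes A :: "real ^ 'm::finite ^ 'n::finite"
  assumes coprime: "coprime CARD('n) CARD('m)" and A: "A \<in> doubly_stochastic_arrays"
  shows "connected_positions (array_support A)"
  unfolding connected_positions_def
proof (intro allI impI)
  fix R :: "'n set" and C :: "'m set"
  assume closed: "\<forall>(i, j)\<in>array_support A. i \<in> R \<longleftrightarrow> j \<in> C"
  have row: "(\<Sum>j\<in>UNIV. A $ i $ j) = real CARD('m)" and col: "(\<Sum>i\<in>UNIV. A $ i $ j) = real CARD('n)"
    for i j
    using A by (auto simp: doubly_stochastic_arrays_def)
  have zero: "A $ i $ j = 0" if "(i \<in> R) \<noteq> (j \<in> C)" for i j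
    using closed that by (auto simp: array_support_def)
  have "real (card R * CARD('m)) = (\<Sum>i\<in>R. \<Sum>j\<in>UNIV. A $ i $ j)"
    by (simp add: row)
  also have "\<dots> = (\<Sum>i\<in>R. \<Sum>j\<in>C. A $ i $ j)"
    by (intro sum.cong refl sum.mono_neutral_right) (auto intro: zero)
  also have "\<dots> = (\<Sum>j\<in>C. \<Sum>i\<in>R. A $ i $ j)"
    by (rule sum.swap)
  also have "\<dots> = (\<Sum>j\<in>C. \<Sum>i\<in>UNIV. A $ i $ j)"
    by (intro sum.cong refl sum.mono_neutral_left) (auto intro: zero)
  also have "\<dots> = real (card C * CARD('n))"
    by (simp add: col)
  finally have mass: "card R * CARD('m) = card C * CARD('n)"
    by (simp only: of_nat_eq_iff)
  then have "CARD('n) dvd card R * CARD('m)"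
    by simp
  then have "CARD('n) dvd card R"
    using coprime by (simp add: coprime_dvd_mult_left_iff)
  moreover have "card R \<le> CARD('n)"
    by (simp add: card_mono)
  ultimately consider "card R = 0" | "card R = CARD('n)"
    by (metis dvd_imp_le le_antisym neq0_conv)
  then show "R = {} \<and> C = {} \<or> R = UNIV \<and> C = UNIV"
  proof cases
    case 1
    with mass have "card C = 0" by simp
    with 1 show ?thesis by simp
  next
    case 2
    with mass have "card C = CARD('m)" by simp
    with 2 show ?thesis by (simp add: card_eq_UNIV_imp_eq_UNIV)
  qed
qed

section \<open>The characterisation of extremal arrays\<close>

theorem theorem1p3:
  fixes A :: "real ^ 'm::finite ^ 'n::finite"
  assumes "coprime CARD('n) CARD('m)"
    and "A \<in> doubly_stochastic_arrays"
  shows "A extreme_point_of doubly_stochastic_arrays \<longleftrightarrow>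
         card (array_support A) = CARD('n) + CARD('m) - 1"
proof -
  have "A extreme_point_of doubly_stochastic_arrays \<longleftrightarrow>
      dim (circulations (array_support A) :: (real ^ 'm ^ 'n) set) = 0"
    by (simp add: extreme_iff_no_circulation[OF assms(2)])
  also have "\<dots> \<longleftrightarrow> card (array_support A) = CARD('n) + CARD('m) - 1"
    using dim_circulations[OF connected_support[OF assms]] by linarith
  finally show ?thesis .
qed

end
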